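(* Let $(A,\cdot,\circ)$ be a transposed Novikov-Poisson algebra over $\mathbf{k}$ and let $D:A\to A$ be a linear map that is a derivation of both $(A,\cdot)$ and $(A,\circ)$. Then: (a) The triple $(A,\cdot,[\cdot,\cdot])$ is a transposed Poisson algebra, where $[x,y]=x\circ y-y\circ x$ for all $x,y\in A$. (b) The triple $(A,\cdot,[\cdot,\cdot])$ is a transposed Poisson algebra, where $[x,y]=D(x)\circ y-D(y)\circ x$ for all $x,y\in A$.
   Context: $\mathbf{k}$ is a field of characteristic not equal to $2$; all binary operations are $\mathbf{k}$-bilinear. A (left) Novikov algebra $(A,\circ)$ is a vector space with a binary operation satisfying $(x\circ y)\circ z=(x\circ z)\circ y$ and $(x\circ y)\circ z-x\circ(y\circ z)=(y\circ x)\circ z-y\circ(x\circ z)$ for all $x,y,z$. A transposed Novikov-Poisson algebra is a triple $(A,\cdot,\circ)$ where $(A,\cdot)$ is a commutative associative algebra (not necessarily unital), $(A,\circ)$ is a Novikov algebra, and for all $x,y,z\in A$: $(x\cdot y)\circ z=(x\cdot z)\circ y$ and $2z\cdot(x\circ y)=(z\cdot x)\circ y+x\circ(z\cdot y)$. A transposed Poisson algebra is a triple $(L,\cdot,[\cdot,\cdot])$ where $(L,\cdot)$ is a commutative associative algebra, $(L,[\cdot,\cdot])$ is a Lie algebra, and $2z\cdot[x,y]=[z\cdot x,y]+[x,z\cdot y]$ for all $x,y,z\in L$. A derivation of $(A,\ast)$ is a linear map $D$ with $D(x\ast y)=D(x)\ast y+x\ast D(y)$ for all $x,y\in A$. *)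

theory Defs
  imports Complex_Main
begin

locale nonassoc_algebra = vector_space scale
  for scale :: "'k::field \<Rightarrow> 'a::ab_group_add \<Rightarrow> 'a" +
  fixes mult :: "'a \<Rightarrow> 'a \<Rightarrow> 'a"
  assumes linear_left: "\<And>y. Vector_Spaces.linear scale scale (\<lambda>x. mult x y)"
    and linear_right: "\<And>x. Vector_Spaces.linear scale scale (\<lambda>y. mult x y)"

locale comm_assoc_algebra = nonassoc_algebra scale mult
  for scale :: "'k::field \<Rightarrow> 'a::ab_group_add \<Rightarrow> 'a"
    and mult :: "'a \<Rightarrow> 'a \<Rightarrow> 'a" +
  assumes mult_commute: "\<And>x y. mult x y = mult y x"
    and mult_assoc: "\<And>x y z. mult (mult x y) z = mult x (mult y z)"

locale lie_algebra = nonassoc_algebra scale bracket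
  for scale :: "'k::field \<Rightarrow> 'a::ab_group_add \<Rightarrow> 'a"
    and bracket :: "'a \<Rightarrow> 'a \<Rightarrow> 'a" +
  assumes bracket_self: "\<And>x. bracket x x = 0"
    and jacobi: "\<And>x y z.
      bracket x (bracket y z) + bracket y (bracket z x) + bracket z (bracket x y) = 0"

text \<open>Left Novikov algebras: left-symmetric and right-commutative.\<close>

locale novikov_algebra = nonassoc_algebra scale circ
  for scale :: "'k::field \<Rightarrow> 'a::ab_group_add \<Rightarrow> 'a"
    and circ :: "'a \<Rightarrow> 'a \<Rightarrow> 'a" +
  assumes right_commutative: "\<And>x y z. circ (circ x y) z = circ (circ x z) y"
    and left_symmetric: "\<And>x y z.
      circ (circ x y) z - circ x (circ y z) = circ (circ y x) z - circ y (circ x z)"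

locale transposed_novikov_poisson_algebra =
  dot: comm_assoc_algebra scale dot + circ: novikov_algebra scale circ
  for scale :: "'k::field \<Rightarrow> 'a::ab_group_add \<Rightarrow> 'a"
    and dot :: "'a \<Rightarrow> 'a \<Rightarrow> 'a"
    and circ :: "'a \<Rightarrow> 'a \<Rightarrow> 'a" +
  assumes dot_circ_swap: "\<And>x y z. circ (dot x y) z = circ (dot x z) y"
    and transposed_leibniz: "\<And>x y z.
      scale 2 (dot z (circ x y)) = circ (dot z x) y + circ x (dot z y)"

locale transposed_poisson_algebra =
  dot: comm_assoc_algebra scale dot + bracket: lie_algebra scale bracket
  for scale :: "'k::field \<Rightarrow> 'a::ab_group_add \<Rightarrow> 'a"
    and dot :: "'a \<Rightarrow> 'a \<Rightarrow> 'a"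
    and bracket :: "'a \<Rightarrow> 'a \<Rightarrow> 'a" +
  assumes transposed_leibniz: "\<And>x y z.
    scale 2 (dot z (bracket x y)) = bracket (dot z x) y + bracket x (dot z y)"

definition (in nonassoc_algebra) derivation :: "('a \<Rightarrow> 'a) \<Rightarrow> bool" where
  "derivation D \<longleftrightarrow> Vector_Spaces.linear scale scale D \<and>
    (\<forall>x y. D (mult x y) = mult (D x) y + mult x (D y))"

end

theory Submission
  imports Defs
begin

text \<open>
  Both brackets have the form \<open>[x, y] = E x \<circ> y - E y \<circ> x\<close>, with \<open>E\<close> the identity in (a) and
  \<open>E = D\<close> in (b). Bilinearity and antisymmetry hold for every linear \<open>E\<close>.

  For \<open>E = id\<close>, the Jacobi identity holds because the associator of a left-symmetric
  product is symmetric in its first two arguments (\<open>commutator_lie_algebra\<close>), and the compatibility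
  with \<open>\<cdot>\<close> is the difference of two instances of the Leibniz rule for \<open>\<circ>\<close>.

  For \<open>E = D\<close>, expanding \<open>D\<close> of a product leaves extra terms in both identities. In the Jacobi
  identity these are \<open>(D (D y) \<circ> z) \<circ> x\<close>, which right-commutativity cancels in pairs; the rest
  is left-symmetry applied to two arguments in the image of \<open>D\<close> and one other
  (\<open>derivation_bracket_lie_algebra\<close>). In the compatibility with \<open>\<cdot>\<close> they are
  \<open>(D z \<cdot> x) \<circ> y - (D z \<cdot> y) \<circ> x\<close>, which vanishes because \<open>(u \<cdot> x) \<circ> y\<close> is symmetric in \<open>x\<close> and \<open>y\<close>.
\<close>

context nonassoc_algebra
begin

lemma mult_distribs:
  "mult (x + y) z = mult x z + mult y z"
  "mult z (x + y) = mult z x + mult z y"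
  "mult (x - y) z = mult x z - mult y z"
  "mult z (x - y) = mult z x - mult z y"
  and mult_scale:
  "mult (scale c x) z = scale c (mult x z)"
  "mult z (scale c x) = scale c (mult z x)"
proof -
  interpret left: Vector_Spaces.linear scale scale "\<lambda>x. mult x z" by (rule linear_left)
  interpret right: Vector_Spaces.linear scale scale "mult z" by (rule linear_right)
  show "mult (x + y) z = mult x z + mult y z" "mult (x - y) z = mult x z - mult y z"
    "mult (scale c x) z = scale c (mult x z)"
    by (fact left.add left.diff left.scale)+
  show "mult z (x + y) = mult z x + mult z y" "mult z (x - y) = mult z x - mult z y"
    "mult z (scale c x) = scale c (mult z x)"
    by (fact right.add right.diff right.scale)+
qed

lemma twisted_commutator_nonassoc_algebra:
  assumes E: "Vector_Spaces.linear scale scale E"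
  shows "nonassoc_algebra scale (\<lambda>x y. mult (E x) y - mult (E y) x)"
proof -
  interpret E: Vector_Spaces.linear scale scale E by (rule E)
  show ?thesis
    by unfold_locales
      (simp_all add: E.add E.scale mult_distribs mult_scale algebra_simps scale_right_diff_distrib)
qed

lemma derivation_linear: "derivation D \<Longrightarrow> Vector_Spaces.linear scale scale D"
  by (simp add: derivation_def)

lemma derivation_mult: "derivation D \<Longrightarrow> D (mult x y) = mult (D x) y + mult x (D y)"
  by (simp add: derivation_def)

lemma derivation_diff: "derivation D \<Longrightarrow> D (x - y) = D x - D y"
  by (rule module_hom.diff[of scale scale])
    (simp add: derivation_def flip: Vector_Spaces.linear_iff_module_hom)

end

context novikov_algebra
begin

text \<open>
  The six associators in the cyclic sum of double commutators occur in pairs that differ by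
  exchanging the first two arguments, with opposite signs.
\<close>

lemma commutator_lie_algebra: "lie_algebra scale (\<lambda>x y. circ x y - circ y x)"
proof -
  interpret comm: nonassoc_algebra scale "\<lambda>x y. circ x y - circ y x"
    by (rule twisted_commutator_nonassoc_algebra[OF linear_ident])
  show ?thesis
  proof unfold_locales
    fix x y z
    show "(circ x (circ y z - circ z y) - circ (circ y z - circ z y) x)
        + (circ y (circ z x - circ x z) - circ (circ z x - circ x z) y)
        + (circ z (circ x y - circ y x) - circ (circ x y - circ y x) z) = 0" (is "?J = 0")
    proof -
      define L where "L u v w = (circ (circ u v) w - circ u (circ v w))
          - (circ (circ v u) w - circ v (circ u w))" for u v w
      have L_0: "L u v w = 0" for u v w
        using left_symmetric[of u v w] by (simp add: L_def)
      have "?J = - (L x y z + L y z x + L z x y)"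
        by (simp add: L_def mult_distribs algebra_simps)
      then show ?thesis
        by (simp add: L_0)
    qed
  qed simp
qed

text \<open>
  \<open>D\<close> applied to an inner bracket produces second derivatives \<open>(D (D y) \<circ> z) \<circ> x\<close>; the cyclic sum
  also contains \<open>(D (D y) \<circ> x) \<circ> z\<close> with the opposite sign, so right-commutativity removes them.
  The remaining terms are three instances of left-symmetry, one for each cyclic rotation.
\<close>

lemma derivation_bracket_lie_algebra:
  assumes D: "derivation D"
  shows "lie_algebra scale (\<lambda>x y. circ (D x) y - circ (D y) x)"
proof -
  interpret br: nonassoc_algebra scale "\<lambda>x y. circ (D x) y - circ (D y) x"
    by (rule twisted_commutator_nonassoc_algebra[OF derivation_linear[OF D]])
  show ?thesis
  proof unfold_locales
    fix x y z
    show "(circ (D x) (circ (D y) z - circ (D z) y) - circ (D (circ (D y) z - circ (D z) y)) x)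
        + (circ (D y) (circ (D z) x - circ (D x) z) - circ (D (circ (D z) x - circ (D x) z)) y)
        + (circ (D z) (circ (D x) y - circ (D y) x) - circ (D (circ (D x) y - circ (D y) x)) z)
        = 0" (is "?J = 0")
    proof -
      define L where "L u v w = (circ (circ u v) w - circ u (circ v w))
          - (circ (circ v u) w - circ v (circ u w))" for u v w
      have L_0: "L u v w = 0" for u v w
        using left_symmetric[of u v w] by (simp add: L_def)
      have "?J = - (L (D x) (D y) z + L (D y) (D z) x + L (D z) (D x) y)"
        using right_commutative[of "D (D x)" y z] right_commutative[of "D (D y)" z x]
          right_commutative[of "D (D z)" x y]
        by (simp add: L_def mult_distribs derivation_diff[OF D] derivation_mult[OF D] algebra_simps)
      then show ?thesis
        by (simp add: L_0)
    qed
  qed simp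
qed

end

context transposed_novikov_poisson_algebra
begin

lemma commutator_transposed_poisson_algebra:
  "transposed_poisson_algebra scale dot (\<lambda>x y. circ x y - circ y x)"
proof -
  interpret bracket: lie_algebra scale "\<lambda>x y. circ x y - circ y x"
    by (rule circ.commutator_lie_algebra)
  show ?thesis
    by unfold_locales
      (simp add: dot.mult_distribs dot.scale_right_diff_distrib transposed_leibniz algebra_simps)
qed

lemma derivation_bracket_transposed_poisson_algebra:
  assumes D_dot: "dot.derivation D" and D_circ: "circ.derivation D"
  shows "transposed_poisson_algebra scale dot (\<lambda>x y. circ (D x) y - circ (D y) x)"
proof -
  interpret bracket: lie_algebra scale "\<lambda>x y. circ (D x) y - circ (D y) x"
    by (rule circ.derivation_bracket_lie_algebra[OF D_circ])
  show ?thesis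
  proof unfold_locales
    fix x y z
    \<comment> \<open>The terms in which \<open>D\<close> falls on \<open>z\<close> have no counterpart on the left; they cancel here.\<close>
    have "circ (dot (D z) x) y = circ (dot (D z) y) x"
      by (rule dot_circ_swap)
    then show "scale 2 (dot z (circ (D x) y - circ (D y) x))
        = (circ (D (dot z x)) y - circ (D y) (dot z x))
          + (circ (D x) (dot z y) - circ (D (dot z y)) x)"
      by (simp add: dot.mult_distribs circ.mult_distribs dot.scale_right_diff_distrib
          transposed_leibniz dot.derivation_mult[OF D_dot] algebra_simps)
  qed
qed

end

theorem theorem2p1:
  fixes scale :: "'k::field \<Rightarrow> 'a::ab_group_add \<Rightarrow> 'a"
    and dot circ :: "'a \<Rightarrow> 'a \<Rightarrow> 'a"
    and D :: "'a \<Rightarrow> 'a"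
  assumes char_not_2: "CHAR('k) \<noteq> 2"
    and tnp: "transposed_novikov_poisson_algebra scale dot circ"
    and deriv_dot: "nonassoc_algebra.derivation scale dot D"
    and deriv_circ: "nonassoc_algebra.derivation scale circ D"
  shows "transposed_poisson_algebra scale dot (\<lambda>x y. circ x y - circ y x)
    \<and> transposed_poisson_algebra scale dot (\<lambda>x y. circ (D x) y - circ (D y) x)"
proof -
  interpret transposed_novikov_poisson_algebra scale dot circ by (rule tnp)
  show ?thesis
    using commutator_transposed_poisson_algebra
      derivation_bracket_transposed_poisson_algebra[OF deriv_dot deriv_circ] by blast
qed

end
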